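(* Let $Y=\mu+\xi$ with $\mu\in\mathbb{R}^n$ and $\xi\sim\mathcal{N}(0,\sigma^2 I_n)$, let $\hat\mu_j=A_jY+b_j$, $j\in[M]$, be affine estimators of $\mu$ with deterministic symmetric positive semidefinite $n\times n$ matrices $A_j$ and deterministic $b_j\in\mathbb{R}^n$, let $\pi=(\pi_1,\dots,\pi_M)$ be a probability distribution on $[M]$, and let $V=\max_{j\in[M]}\|A_j\|_{\mathrm{op}}>0$. Let $\hat\mu^{\mathsf{EW}}=\sum_{j=1}^M\hat\theta_j\hat\mu_j$ be the aggregate with exponential weights $$\hat\theta_j\propto\pi_j\exp\Big(-\frac{\|Y-\hat\mu_j\|^2+C_j}{\lambda}\Big),\quad j\in[M],\qquad \sum_{j=1}^M\hat\theta_j=1,$$ with tuning parameter $\lambda\ge4\sigma^2\max(16,5V)$. Then for any $\delta>0$, with probability at least $1-\delta$, $$\|\mu-\hat\mu^{\mathsf{EW}}\|^2\le\min_{j\in[M]}\Big\{\Big(1+\frac{128\sigma^2}{3\lambda}\Big)\|\mu-\hat\mu_j\|^2+3\lambda\log\Big(\frac1{\delta\pi_j}\Big)+2C_j\Big\}.$$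
   Context: $[M]=\{1,\dots,M\}$, $M\ge2$; $\|\cdot\|$ is the Euclidean norm, $\|\cdot\|_{\mathrm{op}}$ the operator norm, $\mathrm{Tr}$ the trace. The mean $\mu$ is deterministic and unknown, $\sigma^2>0$ is known. $C_j=4\sigma^2\,\mathrm{Tr}(A_j)$. Convention: $\log(1/0)=+\infty$. *)

theory Defs
  imports "HOL-Probability.Probability"
begin

(* The density of N(m, \<sigma>^2 I_n) with n = CARD('n), for \<sigma> > 0. As in normal_density, the parameter
   is the standard deviation \<sigma>, not the variance. *)
definition iso_normal_density :: "real ^ 'n \<Rightarrow> real \<Rightarrow> real ^ 'n \<Rightarrow> real" where
  "iso_normal_density m \<sigma> x =
     1 / sqrt (2 * pi * \<sigma>\<^sup>2) ^ CARD('n) * exp (- (norm (x - m))\<^sup>2 / (2 * \<sigma>\<^sup>2))"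

definition sym_psd :: "real ^ 'n ^ 'n \<Rightarrow> bool" where
  "sym_psd A \<longleftrightarrow> transpose A = A \<and> (\<forall>x. 0 \<le> x \<bullet> (A *v x))"

definition op_norm :: "real ^ 'n ^ 'n \<Rightarrow> real" where
  "op_norm A = onorm (\<lambda>x. A *v x)"

definition affine_est :: "real ^ 'n ^ 'n \<Rightarrow> real ^ 'n \<Rightarrow> real ^ 'n \<Rightarrow> real ^ 'n" where
  "affine_est A b y = A *v y + b"

definition penalty :: "real \<Rightarrow> real ^ 'n ^ 'n \<Rightarrow> real" where
  "penalty \<sigma> A = 4 * \<sigma>\<^sup>2 * trace A"

definition ew_unnormalized ::
  "real \<Rightarrow> real \<Rightarrow> (nat \<Rightarrow> real ^ 'n ^ 'n) \<Rightarrow> (nat \<Rightarrow> real ^ 'n) \<Rightarrow> (nat \<Rightarrow> real) \<Rightarrow> real ^ 'n \<Rightarrow> nat \<Rightarrow> real" where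
  "ew_unnormalized \<sigma> lam A b \<pi> y j =
     \<pi> j * exp (- ((norm (y - affine_est (A j) (b j) y))\<^sup>2 + penalty \<sigma> (A j)) / lam)"

definition ew_weight ::
  "nat \<Rightarrow> real \<Rightarrow> real \<Rightarrow> (nat \<Rightarrow> real ^ 'n ^ 'n) \<Rightarrow> (nat \<Rightarrow> real ^ 'n) \<Rightarrow> (nat \<Rightarrow> real) \<Rightarrow> real ^ 'n \<Rightarrow> nat \<Rightarrow> real" where
  "ew_weight M \<sigma> lam A b \<pi> y j =
     ew_unnormalized \<sigma> lam A b \<pi> y j / (\<Sum>k = 1..M. ew_unnormalized \<sigma> lam A b \<pi> y k)"

definition ew_aggregate ::
  "nat \<Rightarrow> real \<Rightarrow> real \<Rightarrow> (nat \<Rightarrow> real ^ 'n ^ 'n) \<Rightarrow> (nat \<Rightarrow> real ^ 'n) \<Rightarrow> (nat \<Rightarrow> real) \<Rightarrow> real ^ 'n \<Rightarrow> real ^ 'n" where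
  "ew_aggregate M \<sigma> lam A b \<pi> y =
     (\<Sum>j = 1..M. ew_weight M \<sigma> lam A b \<pi> y j *\<^sub>R affine_est (A j) (b j) y)"

(* log (1 / x) for x >= 0, with the convention log (1 / 0) = \<infinity>
   (whereas ln (1 / 0) = 0 for the real logarithm of the library). *)
definition log_recip :: "real \<Rightarrow> ereal" where
  "log_recip x = (if x = 0 then \<infinity> else ereal (ln (1 / x)))"

end

theory Submission
  imports Defs
begin

text \<open>
  Let \<open>L j\<close> be the loss \<open>\<parallel>\<mu> - \<mu>\<^sub>j\<parallel>\<^sup>2\<close> of the \<open>j\<close>-th estimator \<open>\<mu>\<^sub>j\<close>, \<open>C j\<close> its penalty and
  \<open>g j = \<parallel>Y - \<mu>\<^sub>j\<parallel>\<^sup>2 + C j\<close>. By convexity the loss of the aggregate is at most the average of \<open>L\<close> under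
  the exponential weights \<open>\<theta>\<close>. Expanding the squares with \<open>Y = \<mu> + \<xi>\<close> gives
  \<open>g j - g k = L j - L k - 2 \<xi> \<bullet> (\<mu>\<^sub>j - \<mu>\<^sub>k) + C j - C k\<close>, so the losses can be compared once the cross
  term is under control. To this end, put \<open>\<epsilon> = 16 \<sigma>\<^sup>2 / \<lambda>\<close> and call
  \<open>Z j k = 2 \<xi> \<bullet> (\<mu>\<^sub>j - \<mu>\<^sub>k) - C j - \<epsilon> L j - \<epsilon> L k\<close> the excess of \<open>j\<close> over \<open>k\<close>.

  The weights are a Gibbs distribution with energy \<open>g\<close> and prior \<open>\<pi>\<close>. Jensen's inequality for \<open>exp\<close>
  (\<open>gibbs_average_le\<close>) therefore bounds the \<open>\<theta>\<close>-average of \<open>Z j k + g j\<close> by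
  \<open>g k + \<lambda> log (K / \<pi> k)\<close>, where \<open>K\<close> is any bound on the \<open>\<pi>\<close>-average over \<open>j\<close> of \<open>exp (Z j k / \<lambda>)\<close>.
  Suppose that the expectation of \<open>exp (Z j k / \<lambda>)\<close> is at most 1 for all \<open>j\<close> and \<open>k\<close>. Then so is that
  of the average over both indices with respect to \<open>\<pi>\<close>, and by Markov's inequality this double
  average is at most \<open>1 / \<delta>\<close> with probability at least \<open>1 - \<delta>\<close>. On this event \<open>K = 1 / (\<delta> \<pi> k)\<close> works
  for all \<open>k\<close> at once, and
  \<open>(1 - \<epsilon>) (\<Sum>j. \<theta> j L j) \<le> (1 + \<epsilon>) L k + C k + 2 \<lambda> log (1 / (\<delta> \<pi> k))\<close>.
  Since \<open>\<epsilon> \<le> 1 / 4\<close>, division by \<open>1 - \<epsilon>\<close> gives the constants of the theorem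
  (\<open>ew_oracle_inequality_of_excess_bound\<close>).

  It remains to bound the exponential moment (\<open>nn_integral_exp_excess_le_1\<close>). Write
  \<open>\<mu>\<^sub>j - \<mu> = r j + A j \<xi>\<close>, so that the cross term has a part that is linear in \<open>\<xi>\<close>, with direction
  \<open>d = r j - r k\<close>, and two quadratic parts, the one from \<open>A k\<close> being favourable. The subtracted losses
  yield \<open>- (\<epsilon> / 4) \<parallel>d\<parallel>\<^sup>2\<close> at the price of increasing the quadratic part from \<open>A j\<close> a little
  (\<open>quadratic_noise_absorbed_by_losses\<close>); here \<open>\<lambda> \<ge> 20 \<sigma>\<^sup>2 V\<close> is used. The linear part and the quadratic
  part are then separated by \<open>2 a b \<le> a\<^sup>2 + b\<^sup>2\<close>. The linear one is an explicit Gaussian integral and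
  determines \<open>\<epsilon>\<close>. The quadratic one reduces to one-dimensional integrals after diagonalizing \<open>A j\<close>,
  because the Gaussian density and Lebesgue measure are rotation invariant, and is paid for by the
  penalty (\<open>nn_integral_gaussian_exp_quadratic_le\<close>).
\<close>

section \<open>Diagonalization of symmetric positive semidefinite matrices\<close>

text \<open>
  The eigenvector is a maximizer \<open>v\<close> of the Rayleigh quotient on the unit sphere of \<open>S\<close>. The
  residual \<open>g = f v - l v\<close> is a direction within \<open>S\<close>, and moving from \<open>v\<close> along \<open>g\<close> by a small \<open>t > 0\<close>
  would increase the quotient by \<open>2 t (g \<bullet> g)\<close> to first order; so \<open>g\<close> vanishes.
\<close>

lemma selfadjoint_has_eigenvector_in_invariant_subspace:
  fixes f :: "'a::euclidean_space \<Rightarrow> 'a"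
  assumes lin: "linear f" and sym: "\<And>x y. f x \<bullet> y = x \<bullet> f y"
    and S: "subspace S" "f ` S \<subseteq> S" "S \<noteq> {0}"
  obtains v where "v \<in> S" "norm v = 1" "f v = (v \<bullet> f v) *\<^sub>R v"
proof -
  interpret linear f by fact
  have "compact (S \<inter> sphere 0 1)"
    using S(1) by (simp add: closed_Int_compact closed_subspace)
  moreover have "S \<inter> sphere 0 1 \<noteq> {}"
  proof -
    obtain x where "x \<in> S" "x \<noteq> 0" using S subspace_0 by blast
    then have "x /\<^sub>R norm x \<in> S \<inter> sphere 0 1"
      using S(1) by (simp add: subspace_scale)
    then show ?thesis by blast
  qed
  moreover have "continuous_on (S \<inter> sphere 0 1) (\<lambda>x. x \<bullet> f x)"
    using lin by (intro continuous_intros linear_continuous_on) (simp add: linear_conv_bounded_linear)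
  ultimately obtain v where v: "v \<in> S \<inter> sphere 0 1"
    and max: "\<And>x. x \<in> S \<inter> sphere 0 1 \<Longrightarrow> x \<bullet> f x \<le> v \<bullet> f v"
    using continuous_attains_sup by metis
  define l where "l = v \<bullet> f v"
  have vS: "v \<in> S" and nv: "norm v = 1" using v by auto
  have rayleigh: "w \<bullet> f w \<le> l * (w \<bullet> w)" if "w \<in> S" for w
  proof (cases "w = 0")
    case True then show ?thesis by simp
  next
    case False
    have "(w /\<^sub>R norm w) \<bullet> f (w /\<^sub>R norm w) \<le> l"
      unfolding l_def using False that S(1) by (intro max) (auto simp: subspace_scale)
    then have "(w \<bullet> f w) / (norm w)\<^sup>2 \<le> l"
      by (simp add: scale power2_eq_square field_simps)
    then show ?thesis
      using False by (simp add: divide_simps power2_norm_eq_inner mult.commute)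
  qed
  define g where "g = f v - l *\<^sub>R v"
  have gS: "g \<in> S"
    unfolding g_def using vS S by (intro subspace_diff subspace_scale) auto
  have pert: "2 * t * (g \<bullet> g) \<le> t\<^sup>2 * (l * (g \<bullet> g) - g \<bullet> f g)" for t
  proof -
    have "(v + t *\<^sub>R g) \<bullet> f (v + t *\<^sub>R g) \<le> l * ((v + t *\<^sub>R g) \<bullet> (v + t *\<^sub>R g))"
      using vS gS S(1) by (intro rayleigh subspace_add subspace_scale)
    moreover have "v \<bullet> f g = g \<bullet> f v" by (metis inner_commute sym)
    moreover have "v \<bullet> v = 1" using nv by (simp add: norm_eq_1)
    ultimately have "2 * t * (g \<bullet> f v - l * (v \<bullet> g)) \<le> t\<^sup>2 * (l * (g \<bullet> g) - g \<bullet> f g)"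
      by (simp add: add scale inner_add_left inner_add_right l_def[symmetric] power2_eq_square
        inner_commute algebra_simps)
    moreover have "g \<bullet> f v - l * (v \<bullet> g) = g \<bullet> g"
      by (subst (3) g_def) (simp add: inner_diff_right inner_commute)
    ultimately show ?thesis by simp
  qed
  have "g \<bullet> g \<le> 0"
  proof (rule ccontr)
    assume "\<not> g \<bullet> g \<le> 0"
    define c where "c = l * (g \<bullet> g) - g \<bullet> f g"
    define t where "t = (g \<bullet> g) / (\<bar>c\<bar> + 1)"
    have t: "0 < t"
      unfolding t_def using \<open>\<not> g \<bullet> g \<le> 0\<close> by (intro divide_pos_pos) auto
    have "t * (2 * (g \<bullet> g)) \<le> t * (t * c)"
      using pert[of t] by (simp add: c_def power2_eq_square algebra_simps)
    then have "2 * (g \<bullet> g) \<le> t * c" using t by simp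
    also have "\<dots> \<le> t * (\<bar>c\<bar> + 1)" using t by (intro mult_left_mono) auto
    also have "\<dots> = g \<bullet> g" by (simp add: t_def)
    finally show False using \<open>\<not> g \<bullet> g \<le> 0\<close> by simp
  qed
  then have "g = 0" by (meson inner_gt_zero_iff not_less)
  then have "f v = (v \<bullet> f v) *\<^sub>R v" by (simp add: g_def l_def)
  with vS nv show ?thesis by (rule that)
qed

text \<open>
  The orthogonal complement of an eigenvector within an invariant subspace is again invariant, which
  allows induction on the dimension.
\<close>

lemma selfadjoint_orthonormal_eigenbasis:
  fixes f :: "'a::euclidean_space \<Rightarrow> 'a"
  assumes lin: "linear f" and sym: "\<And>x y. f x \<bullet> y = x \<bullet> f y"
    and "subspace S" "f ` S \<subseteq> S"
  shows "\<exists>B \<subseteq> S. pairwise orthogonal B \<and> (\<forall>b\<in>B. norm b = 1 \<and> f b = (b \<bullet> f b) *\<^sub>R b) \<and> S \<subseteq> span B"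
  using assms(3,4)
proof (induction "dim S" arbitrary: S rule: less_induct)
  case less
  show ?case
  proof (cases "S = {0}")
    case True
    then show ?thesis by (intro exI[of _ "{}"]) auto
  next
    case False
    obtain v where v: "v \<in> S" "norm v = 1" "f v = (v \<bullet> f v) *\<^sub>R v"
      using selfadjoint_has_eigenvector_in_invariant_subspace[OF lin sym less.prems False] by blast
    define T where "T = S \<inter> {x. orthogonal v x}"
    have T: "subspace T"
      unfolding T_def by (rule subspace_inter[OF less.prems(1) subspace_orthogonal_to_vector])
    have "orthogonal v (f x)" if "orthogonal v x" for x
      using that v(3) unfolding orthogonal_def by (metis inner_scaleR_left mult_zero_right sym)
    then have "f ` T \<subseteq> T" using less.prems(2) by (auto simp: T_def)
    moreover have "v \<notin> T" using v(2) by (auto simp: T_def orthogonal_def)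
    then have "dim T < dim S"
      using T less.prems(1) v(1) by (intro dim_psubset) (auto simp: span_eq_iff[THEN iffD2] T_def)
    ultimately obtain B where B: "B \<subseteq> T" "pairwise orthogonal B" "T \<subseteq> span B"
        "\<forall>b\<in>B. norm b = 1 \<and> f b = (b \<bullet> f b) *\<^sub>R b"
      using less.hyps[of T] T by blast
    have "S \<subseteq> span (insert v B)"
    proof
      fix x assume "x \<in> S"
      have "v \<bullet> v = 1" using v(2) by (simp add: norm_eq_1)
      then have "x - (v \<bullet> x) *\<^sub>R v \<in> T"
        using \<open>x \<in> S\<close> v(1) less.prems(1)
        by (auto simp: T_def orthogonal_def inner_diff_right intro!: subspace_diff subspace_scale)
      then show "x \<in> span (insert v B)" using B(3) by (auto simp: span_breakdown_eq)
    qed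
    moreover have "pairwise orthogonal (insert v B)"
      using B(1,2) by (auto simp: pairwise_insert T_def orthogonal_commute)
    moreover have "insert v B \<subseteq> S" using B(1) v(1) by (auto simp: T_def)
    ultimately show ?thesis
      using B(4) v(2,3) by (intro exI[of _ "insert v B"]) simp
  qed
qed

text \<open>
  The columns of \<open>Q\<close> form an eigenbasis. In the coordinates \<open>z\<close> with \<open>x = Q z\<close>, quadratic forms of \<open>A\<close>
  are weighted sums of squares, while norms, and with them the centred Gaussian density, are unchanged.
\<close>

lemma sym_psd_diagonalization:
  fixes A :: "real ^ 'n ^ 'n"
  assumes "sym_psd A"
  obtains Q :: "real ^ 'n ^ 'n" and a :: "'n \<Rightarrow> real" where "orthogonal_matrix Q"
    "\<And>i. 0 \<le> a i" "\<And>i. a i \<le> op_norm A"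
    "\<And>z. A *v (Q *v z) = Q *v (\<chi> i. a i * z $ i)" "trace A = (\<Sum>i\<in>UNIV. a i)"
proof -
  have lin: "linear (\<lambda>x. A *v x)" by (rule matrix_vector_mul_linear)
  have sym: "(A *v x) \<bullet> y = x \<bullet> (A *v y)" for x y
    using assms by (metis dot_lmul_matrix sym_psd_def transpose_matrix_vector)
  obtain B where B: "pairwise orthogonal B" "UNIV \<subseteq> span B"
      "\<And>u. u \<in> B \<Longrightarrow> norm u = 1" "\<And>u. u \<in> B \<Longrightarrow> A *v u = (u \<bullet> (A *v u)) *\<^sub>R u"
    using selfadjoint_orthonormal_eigenbasis[OF lin sym subspace_UNIV] by blast
  have "independent B"
    using B(1,3) by (intro pairwise_orthogonal_independent) (auto dest: B(3)[of 0])
  then have "finite B" "card B = CARD('n)"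
    using B(2) basis_card_eq_dim[of B UNIV] by (auto simp: independent_imp_finite)
  then obtain h :: "'n \<Rightarrow> real ^ 'n" where h: "bij_betw h UNIV B"
    using finite_same_card_bij[of "UNIV :: 'n set" B] by auto
  then have hB: "h i \<in> B" for i by (auto simp: bij_betw_def)
  define Q :: "real ^ 'n ^ 'n" where "Q = (\<chi> i j. h j $ i)"
  define a where "a i = h i \<bullet> (A *v h i)" for i
  have col: "column j Q = h j" for j by (simp add: column_def Q_def vec_eq_iff)
  have "orthogonal (h i) (h j)" if "i \<noteq> j" for i j
    using pairwiseD[OF B(1) hB hB] h that by (metis bij_betw_imp_inj_on injD)
  then have orth: "orthogonal_matrix Q"
    unfolding orthogonal_matrix_orthonormal_columns col using B(3)[OF hB] by simp
  have eig: "A *v h i = a i *\<^sub>R h i" for i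
    using B(4)[OF hB] by (simp add: a_def)
  have nneg: "0 \<le> a i" for i using assms by (simp add: a_def sym_psd_def)
  moreover have "a i \<le> op_norm A" for i
  proof -
    have "a i = norm (A *v h i)" using eig[of i] B(3)[OF hB] nneg[of i] by simp
    also have "\<dots> \<le> op_norm A * norm (h i)"
      unfolding op_norm_def by (rule onorm[OF matrix_vector_mul_bounded_linear])
    finally show ?thesis using B(3)[OF hB] by simp
  qed
  moreover have AQ: "A *v (Q *v z) = Q *v (\<chi> i. a i * z $ i)" for z
  proof -
    have Qz: "Q *v z = (\<Sum>i\<in>UNIV. z $ i *\<^sub>R h i)" for z
      by (simp add: matrix_mult_sum col scalar_mult_eq_scaleR)
    show ?thesis
      by (simp add: Qz linear_sum[OF lin] matrix_vector_mult_scaleR eig mult.commute)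
  qed
  moreover have "trace A = (\<Sum>i\<in>UNIV. a i)"
  proof -
    define D :: "real ^ 'n ^ 'n" where "D = (\<chi> i j. if i = j then a i else 0)"
    have "D *v z = (\<chi> i. a i * z $ i)" for z
      by (simp add: D_def matrix_vector_mult_def vec_eq_iff if_distrib[where f="\<lambda>x. x * _"] cong: if_cong)
    then have "(A ** Q) *v z = (Q ** D) *v z" for z
      by (metis AQ matrix_vector_mul_assoc)
    then have "A ** Q = Q ** D" by (simp add: matrix_eq)
    then have "A = (Q ** D) ** transpose Q"
      using orth by (metis matrix_mul_assoc matrix_mul_rid orthogonal_matrix_def)
    then have "trace A = trace (transpose Q ** (Q ** D))" by (metis trace_mul_sym)
    also have "\<dots> = trace D"
      using orth by (simp add: matrix_mul_assoc orthogonal_matrix_def)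
    finally show ?thesis by (simp add: trace_def D_def)
  qed
  ultimately show ?thesis using orth that by blast
qed

lemma sym_psd_trace_nonneg:
  fixes A :: "real ^ 'n ^ 'n"
  assumes "sym_psd A"
  shows "0 \<le> trace A"
proof -
  have "A $ i $ i = axis i 1 \<bullet> (A *v axis i 1)" for i
    by (simp add: inner_axis' matrix_vector_mult_basis column_def)
  then show ?thesis using assms by (auto simp: trace_def sym_psd_def intro!: sum_nonneg)
qed

text \<open>
  In an eigenbasis the two sides are \<open>\<Sum>i. (a i)\<^sup>2 (z i)\<^sup>2\<close> and \<open>op_norm A * (\<Sum>i. a i (z i)\<^sup>2)\<close>. This is how
  the noise term \<open>A x\<close> inside a loss is compared with the quadratic form of \<open>A\<close>.
\<close>

lemma sym_psd_norm_square_le: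
  fixes A :: "real ^ 'n ^ 'n"
  assumes "sym_psd A"
  shows "(norm (A *v x))\<^sup>2 \<le> op_norm A * (x \<bullet> (A *v x))"
proof -
  obtain Q a where Q: "orthogonal_matrix Q" "\<And>i. 0 \<le> a i" "\<And>i. a i \<le> op_norm A"
      and AQ: "\<And>z. A *v (Q *v z) = Q *v (\<chi> i. a i * z $ i)"
    using sym_psd_diagonalization[OF assms] by metis
  have orth: "orthogonal_transformation ((*v) Q)"
    using Q(1) by (simp add: orthogonal_transformation_matrix)
  then obtain z where x: "x = Q *v z"
    by (metis orthogonal_transformation_surj surjD)
  have "(norm (A *v x))\<^sup>2 = (\<Sum>i\<in>UNIV. a i * (a i * (z $ i)\<^sup>2))"
    using orth unfolding x AQ power2_norm_eq_inner orthogonal_transformation_def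
    by (simp add: inner_vec_def power2_eq_square algebra_simps)
  also have "\<dots> \<le> (\<Sum>i\<in>UNIV. op_norm A * (a i * (z $ i)\<^sup>2))"
    by (intro sum_mono mult_right_mono Q mult_nonneg_nonneg) auto
  also have "\<dots> = op_norm A * (x \<bullet> (A *v x))"
    using orth unfolding x AQ orthogonal_transformation_def
    by (simp add: inner_vec_def power2_eq_square sum_distrib_left algebra_simps)
  finally show ?thesis .
qed

section \<open>Rotation invariance of Lebesgue measure\<close>

lemma nn_integral_lborel_translate:
  fixes f :: "'a::euclidean_space \<Rightarrow> ennreal"
  assumes [measurable]: "f \<in> borel_measurable borel"
  shows "(\<integral>\<^sup>+x. f (c + x) \<partial>lborel) = (\<integral>\<^sup>+x. f x \<partial>lborel)"
proof -
  have "(\<integral>\<^sup>+x. f x \<partial>lborel) = (\<integral>\<^sup>+x. f x \<partial>distr lborel borel ((+) c))"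
    by (simp add: lborel_distr_plus)
  then show ?thesis by (simp add: nn_integral_distr)
qed

lemma nn_integral_lborel_reflect:
  fixes f :: "'a::euclidean_space \<Rightarrow> ennreal"
  assumes [measurable]: "f \<in> borel_measurable borel"
  shows "(\<integral>\<^sup>+x. f (c - x) \<partial>lborel) = (\<integral>\<^sup>+x. f x \<partial>lborel)"
proof -
  have "(lborel :: 'a measure) = distr lborel borel (\<lambda>x. c + (-1) *\<^sub>R x)"
    using lborel_affine[of "-1" c] by (simp add: density_1)
  then have "(\<integral>\<^sup>+x. f x \<partial>lborel) = (\<integral>\<^sup>+x. f x \<partial>distr lborel borel (\<lambda>x. c + (-1) *\<^sub>R x))"
    by (rule arg_cong)
  then show ?thesis by (simp add: nn_integral_distr)
qed

text \<open>
  The proof is the uniqueness argument for Haar measure. For a fixed radial weight \<open>g\<close> with finite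
  nonzero integral \<open>G\<close>, Tonelli's theorem and translation invariance turn
  \<open>(\<integral> f (T x) dx) * G\<close> into \<open>\<integral> f y (\<integral> g (y - T x) dx) dy\<close>. As \<open>g\<close> is radial,
  \<open>g (y - T x) = g (inverse T y - x)\<close>, and by reflection and translation the inner integral equals
  \<open>G\<close> for every \<open>y\<close>.
\<close>

lemma nn_integral_lborel_orthogonal_transformation:
  fixes T :: "'a::euclidean_space \<Rightarrow> 'a" and f :: "'a \<Rightarrow> ennreal"
  assumes T: "orthogonal_transformation T" and [measurable]: "f \<in> borel_measurable borel"
  shows "(\<integral>\<^sup>+x. f (T x) \<partial>lborel) = (\<integral>\<^sup>+x. f x \<partial>lborel)"
proof -
  define g :: "'a \<Rightarrow> ennreal" where "g = indicator (ball 0 1)"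
  have [measurable]: "g \<in> borel_measurable borel" by (auto simp: g_def intro: borel_measurable_indicator)
  have lin: "linear T" using T by (rule orthogonal_transformation_linear)
  have [measurable]: "T \<in> borel_measurable borel"
    using lin by (intro borel_measurable_continuous_onI linear_continuous_on)
      (simp add: linear_conv_bounded_linear)
  have T_inv: "T (inv T y) = y" for y
    using orthogonal_transformation_surj[OF T] by (rule surj_f_inv_f)
  define G where "G = (\<integral>\<^sup>+x. g x \<partial>lborel)"
  have G: "G = emeasure lborel (ball 0 1 :: 'a set)"
    by (simp add: G_def g_def)
  have "G \<noteq> 0"
    using content_ball_pos[of 1 "0::'a"] by (auto simp: G measure_def)
  have "G < \<infinity>" unfolding G by (rule emeasure_lborel_ball_finite)
  have g_T: "g (y - T x) = g (inv T y - x)" for x y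
  proof -
    have "y - T x = T (inv T y - x)" using lin by (simp add: linear_diff T_inv)
    then have "norm (y - T x) = norm (inv T y - x)"
      by (simp add: orthogonal_transformation_norm[OF T])
    then show ?thesis by (simp add: g_def indicator_def)
  qed
  have "(\<integral>\<^sup>+x. f (T x) \<partial>lborel) * G = (\<integral>\<^sup>+y. (\<integral>\<^sup>+x. f (T x) \<partial>lborel) * g y \<partial>lborel)"
    unfolding G_def by (simp add: nn_integral_cmult)
  also have "\<dots> = (\<integral>\<^sup>+y. (\<integral>\<^sup>+x. f (T x + y) \<partial>lborel) * g y \<partial>lborel)"
  proof (rule nn_integral_cong)
    fix y
    have "(\<integral>\<^sup>+x. f (T x) \<partial>lborel) = (\<integral>\<^sup>+x. f (T (inv T y + x)) \<partial>lborel)"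
      by (rule nn_integral_lborel_translate[symmetric]) measurable
    also have "\<dots> = (\<integral>\<^sup>+x. f (T x + y) \<partial>lborel)"
      using lin by (simp add: linear_add T_inv add.commute)
    finally show "(\<integral>\<^sup>+x. f (T x) \<partial>lborel) * g y = (\<integral>\<^sup>+x. f (T x + y) \<partial>lborel) * g y"
      by simp
  qed
  also have "\<dots> = (\<integral>\<^sup>+y. (\<integral>\<^sup>+x. f (T x + y) * g y \<partial>lborel) \<partial>lborel)"
    by (simp add: nn_integral_multc)
  also have "\<dots> = (\<integral>\<^sup>+x. (\<integral>\<^sup>+y. f (T x + y) * g y \<partial>lborel) \<partial>lborel)"
    by (rule lborel_pair.Fubini') measurable
  also have "\<dots> = (\<integral>\<^sup>+x. (\<integral>\<^sup>+y. f y * g (y - T x) \<partial>lborel) \<partial>lborel)"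
  proof (rule nn_integral_cong)
    fix x
    show "(\<integral>\<^sup>+y. f (T x + y) * g y \<partial>lborel) = (\<integral>\<^sup>+y. f y * g (y - T x) \<partial>lborel)"
      using nn_integral_lborel_translate[of "\<lambda>y. f y * g (y - T x)" "T x"] by simp
  qed
  also have "\<dots> = (\<integral>\<^sup>+y. (\<integral>\<^sup>+x. f y * g (y - T x) \<partial>lborel) \<partial>lborel)"
    by (rule lborel_pair.Fubini') measurable
  also have "\<dots> = (\<integral>\<^sup>+y. f y * G \<partial>lborel)"
    by (simp add: g_T G_def nn_integral_cmult nn_integral_lborel_reflect)
  also have "\<dots> = (\<integral>\<^sup>+x. f x \<partial>lborel) * G"
    by (simp add: nn_integral_multc)
  finally have "G * (\<integral>\<^sup>+x. f (T x) \<partial>lborel) = G * (\<integral>\<^sup>+x. f x \<partial>lborel)"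
    by (simp add: mult.commute)
  then show ?thesis
    using \<open>G \<noteq> 0\<close> \<open>G < \<infinity>\<close> by (auto simp: ennreal_mult_cancel_left)
qed

section \<open>Exponential moments of Gaussian vectors\<close>

text \<open>
  The estimate \<open>(1 - x) powr (- 1 / 2) \<le> exp (4 / 5 * x)\<close> behind the quadratic moment, in squared form.
  The constant \<open>8 / 5\<close> is what makes the penalty \<open>4 \<sigma>\<^sup>2 trace A\<close> sufficient in the end.
\<close>

lemma one_minus_times_exp_ge_1:
  assumes "0 \<le> x" "x \<le> 1 / 2"
  shows "1 \<le> (1 - x) * exp (8 / 5 * x :: real)"
proof -
  have "x * x \<le> (1 / 2) * (1 / 2)" using assms by (intro mult_mono) auto
  then have "0 \<le> x * (3 / 5 - 8 / 25 * x - 32 / 25 * (x * x))"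
    using assms by (intro mult_nonneg_nonneg) auto
  then have "1 \<le> (1 - x) * (1 + 8 / 5 * x + (8 / 5 * x)\<^sup>2 / 2)"
    by (simp add: power2_eq_square field_simps)
  also have "\<dots> \<le> (1 - x) * exp (8 / 5 * x)"
    using assms exp_lower_Taylor_quadratic[of "8 / 5 * x"] by (intro mult_left_mono) auto
  finally show ?thesis .
qed

text \<open>
  Up to the factor \<open>1 / sqrt w\<close> with \<open>w = 1 - 2 \<sigma>\<^sup>2 t\<close>, the integrand is the centred normal density
  of standard deviation \<open>\<sigma> / sqrt w\<close>.
\<close>

lemma nn_integral_normal_density_exp_square_le:
  fixes \<sigma> t :: real
  assumes "\<sigma> > 0" "0 \<le> t" "2 * \<sigma>\<^sup>2 * t \<le> 1 / 2"
  shows "(\<integral>\<^sup>+x. ennreal (normal_density 0 \<sigma> x * exp (t * x\<^sup>2)) \<partial>lborel)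
    \<le> ennreal (exp (8 / 5 * \<sigma>\<^sup>2 * t))"
proof -
  define w where "w = 1 - 2 * \<sigma>\<^sup>2 * t"
  have w: "w > 0" using assms by (simp add: w_def)
  define \<rho> where "\<rho> = \<sigma> / sqrt w"
  have \<rho>: "\<rho> > 0" using assms(1) w by (simp add: \<rho>_def)
  have "normal_density 0 \<sigma> x * exp (t * x\<^sup>2) = 1 / sqrt w * normal_density 0 \<rho> x" for x
  proof -
    have "- x\<^sup>2 / (2 * \<sigma>\<^sup>2) + t * x\<^sup>2 = - x\<^sup>2 / (2 * \<rho>\<^sup>2)"
      using assms(1) w by (simp add: \<rho>_def power_divide w_def field_simps)
    then have "exp (- x\<^sup>2 / (2 * \<sigma>\<^sup>2)) * exp (t * x\<^sup>2) = exp (- x\<^sup>2 / (2 * \<rho>\<^sup>2))"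
      by (metis exp_add)
    moreover have "1 / sqrt (2 * pi * \<sigma>\<^sup>2) = 1 / sqrt w * (1 / sqrt (2 * pi * \<rho>\<^sup>2))"
      using assms(1) w by (simp add: \<rho>_def power_divide real_sqrt_mult real_sqrt_divide)
    ultimately show ?thesis by (simp add: normal_density_def)
  qed
  then have "(\<integral>\<^sup>+x. ennreal (normal_density 0 \<sigma> x * exp (t * x\<^sup>2)) \<partial>lborel)
      = ennreal (1 / sqrt w) * (\<integral>\<^sup>+x. ennreal (normal_density 0 \<rho> x) \<partial>lborel)"
    using w by (simp add: ennreal_mult'[symmetric] nn_integral_cmult[symmetric])
  also have "(\<integral>\<^sup>+x. ennreal (normal_density 0 \<rho> x) \<partial>lborel) = 1"
    using \<rho> by (simp add: nn_integral_eq_integral)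
  also have "ennreal (1 / sqrt w) * 1 \<le> ennreal (exp (8 / 5 * \<sigma>\<^sup>2 * t))"
  proof -
    have "1 \<le> w * exp (8 / 5 * (2 * \<sigma>\<^sup>2 * t))"
      unfolding w_def using assms by (intro one_minus_times_exp_ge_1) auto
    also have "\<dots> = w * (exp (8 / 5 * \<sigma>\<^sup>2 * t))\<^sup>2"
      by (simp add: power2_eq_square exp_add[symmetric])
    finally have "sqrt 1 \<le> sqrt (w * (exp (8 / 5 * \<sigma>\<^sup>2 * t))\<^sup>2)"
      by (rule real_sqrt_le_mono)
    then have "1 \<le> sqrt w * exp (8 / 5 * \<sigma>\<^sup>2 * t)" by (simp add: real_sqrt_mult)
    then show ?thesis using w by (simp add: field_simps ennreal_leI)
  qed
  finally show ?thesis .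
qed

lemma borel_measurable_iso_normal_density [measurable]:
  "iso_normal_density m \<sigma> \<in> borel_measurable borel"
  unfolding iso_normal_density_def by measurable

lemma iso_normal_density_nonneg [simp]: "0 \<le> iso_normal_density m \<sigma> x"
  by (simp add: iso_normal_density_def)

lemma iso_normal_density_eq_prod:
  fixes x :: "real ^ 'n"
  shows "iso_normal_density 0 \<sigma> x = (\<Prod>i\<in>UNIV. normal_density 0 \<sigma> (x $ i))"
proof -
  have "(norm x)\<^sup>2 = (\<Sum>i\<in>UNIV. (x $ i)\<^sup>2)"
    unfolding power2_norm_eq_inner inner_vec_def by (simp add: power2_eq_square)
  then have "exp (- (norm x)\<^sup>2 / (2 * \<sigma>\<^sup>2)) = (\<Prod>i\<in>UNIV. exp (- (x $ i)\<^sup>2 / (2 * \<sigma>\<^sup>2)))"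
    by (simp add: exp_sum[symmetric] sum_negf sum_divide_distrib)
  then show ?thesis
    by (simp add: iso_normal_density_def normal_density_def prod.distrib power_one_over prod_dividef)
qed

lemma prod_Basis_vec:
  fixes h :: "real ^ 'n \<Rightarrow> 'b::comm_monoid_mult"
  shows "(\<Prod>u\<in>Basis. h u) = (\<Prod>i\<in>UNIV. h (axis i 1))"
proof -
  have Basis: "(Basis :: (real ^ 'n) set) = range (\<lambda>i. axis i 1)"
    by (auto simp: Basis_vec_def)
  have "inj (\<lambda>i. axis i 1 :: real ^ 'n)" by (auto simp: inj_def axis_eq_axis)
  then show ?thesis unfolding Basis by (subst prod.reindex) (simp_all add: comp_def)
qed

text \<open>
  After rotation into an eigenbasis of \<open>A\<close> the integrand is a product over the coordinates, and the
  eigenvalues, collected in the exponents of the factors, add up to the trace.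
\<close>

lemma nn_integral_gaussian_exp_quadratic_le:
  fixes A :: "real ^ 'n ^ 'n"
  assumes "\<sigma> > 0" "sym_psd A" "0 \<le> s" "2 * s * \<sigma>\<^sup>2 * op_norm A \<le> 1 / 2"
  shows "(\<integral>\<^sup>+x. ennreal (iso_normal_density 0 \<sigma> x * exp (s * (x \<bullet> (A *v x)))) \<partial>lborel)
    \<le> ennreal (exp (8 / 5 * \<sigma>\<^sup>2 * s * trace A))"
proof -
  obtain Q a where Q: "orthogonal_matrix Q" and a: "\<And>i. 0 \<le> a i" "\<And>i. a i \<le> op_norm A"
      and AQ: "\<And>z. A *v (Q *v z) = Q *v (\<chi> i. a i * z $ i)"
      and tr: "trace A = (\<Sum>i\<in>UNIV. a i)"
    using sym_psd_diagonalization[OF assms(2)] by metis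
  have orth: "orthogonal_transformation ((*v) Q)"
    using Q by (simp add: orthogonal_transformation_matrix)
  \<comment> \<open>the factor belonging to the basis vector \<open>u\<close>; for \<open>u = axis i 1\<close> the inner product picks the eigenvalue \<open>a i\<close>\<close>
  define f where "f u x = normal_density 0 \<sigma> x * exp (s * (((\<chi> i. a i) \<bullet> u) * x\<^sup>2))" for u :: "real ^ 'n" and x
  have [measurable]: "(\<lambda>x. A *v x) \<in> borel_measurable borel"
    by (intro borel_measurable_continuous_onI linear_continuous_on matrix_vector_mul_bounded_linear)
  have diag: "iso_normal_density 0 \<sigma> (Q *v z) * exp (s * ((Q *v z) \<bullet> (A *v (Q *v z))))
      = (\<Prod>u\<in>Basis. f u (z \<bullet> u))" for z
  proof -
    have "(Q *v z) \<bullet> (A *v (Q *v z)) = (\<Sum>i\<in>UNIV. a i * (z $ i)\<^sup>2)"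
      using orth unfolding AQ orthogonal_transformation_def
      by (simp add: inner_vec_def power2_eq_square algebra_simps)
    moreover have "iso_normal_density 0 \<sigma> (Q *v z) = iso_normal_density 0 \<sigma> z"
      using orthogonal_transformation_norm[OF orth] by (simp add: iso_normal_density_def)
    ultimately show ?thesis
      by (simp add: prod_Basis_vec f_def inner_axis prod.distrib iso_normal_density_eq_prod
          exp_sum[symmetric] sum_distrib_left)
  qed
  have f_le: "(\<integral>\<^sup>+x. ennreal (f (axis i 1) x) \<partial>lborel) \<le> ennreal (exp (8 / 5 * \<sigma>\<^sup>2 * (s * a i)))" for i
  proof -
    have "2 * \<sigma>\<^sup>2 * (s * a i) \<le> 2 * \<sigma>\<^sup>2 * (s * op_norm A)"
      using a(2) assms(3) by (intro mult_left_mono) auto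
    also have "\<dots> \<le> 1 / 2" using assms(4) by (simp add: algebra_simps)
    finally show ?thesis
      using nn_integral_normal_density_exp_square_le[of \<sigma> "s * a i"] assms(1,3) a(1)[of i]
      by (simp add: f_def inner_axis mult.assoc)
  qed
  have "(\<integral>\<^sup>+x. ennreal (iso_normal_density 0 \<sigma> x * exp (s * (x \<bullet> (A *v x)))) \<partial>lborel)
      = (\<integral>\<^sup>+z. ennreal (\<Prod>u\<in>Basis. f u (z \<bullet> u)) \<partial>lborel)"
    unfolding diag[symmetric]
    by (rule nn_integral_lborel_orthogonal_transformation[OF orth, symmetric]) measurable
  also have "\<dots> = (\<integral>\<^sup>+z. (\<Prod>u\<in>Basis. ennreal (f u (z \<bullet> u))) \<partial>lborel)"
    by (simp add: prod_ennreal f_def)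
  also have "\<dots> = (\<Prod>u\<in>Basis. \<integral>\<^sup>+x. ennreal (f u x) \<partial>lborel)"
    by (rule nn_integral_lborel_prod) (simp_all add: f_def)
  also have "\<dots> \<le> (\<Prod>i\<in>UNIV. ennreal (exp (8 / 5 * \<sigma>\<^sup>2 * (s * a i))))"
    unfolding prod_Basis_vec by (intro prod_mono_ennreal f_le)
  also have "\<dots> = ennreal (exp (8 / 5 * \<sigma>\<^sup>2 * s * trace A))"
    by (simp add: prod_ennreal exp_sum[symmetric] tr sum_distrib_left mult.assoc)
  finally show ?thesis .
qed

text \<open>
  Completing the square shifts the centre of the density to \<open>\<sigma>\<^sup>2 c\<close>. That the density has integral
  at most 1 is the quadratic bound for the zero matrix.
\<close>

lemma nn_integral_gaussian_exp_linear_le: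
  fixes c :: "real ^ 'n"
  assumes "\<sigma> > 0"
  shows "(\<integral>\<^sup>+x. ennreal (iso_normal_density 0 \<sigma> x * exp (c \<bullet> x)) \<partial>lborel)
    \<le> ennreal (exp (\<sigma>\<^sup>2 * (norm c)\<^sup>2 / 2))"
proof -
  have "iso_normal_density 0 \<sigma> x * exp (c \<bullet> x)
      = exp (\<sigma>\<^sup>2 * (norm c)\<^sup>2 / 2) * iso_normal_density 0 \<sigma> (- (\<sigma>\<^sup>2 *\<^sub>R c) + x)" for x
  proof -
    have "(norm (x - \<sigma>\<^sup>2 *\<^sub>R c))\<^sup>2 = (norm x)\<^sup>2 - 2 * \<sigma>\<^sup>2 * (c \<bullet> x) + \<sigma>\<^sup>2 * \<sigma>\<^sup>2 * (norm c)\<^sup>2"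
      by (simp add: power2_norm_eq_inner inner_diff_left inner_diff_right inner_commute algebra_simps)
    then have "- (norm x)\<^sup>2 / (2 * \<sigma>\<^sup>2) + c \<bullet> x
        = \<sigma>\<^sup>2 * (norm c)\<^sup>2 / 2 + - (norm (x - \<sigma>\<^sup>2 *\<^sub>R c))\<^sup>2 / (2 * \<sigma>\<^sup>2)"
      using assms by (simp add: field_simps)
    then have "exp (- (norm x)\<^sup>2 / (2 * \<sigma>\<^sup>2)) * exp (c \<bullet> x)
        = exp (\<sigma>\<^sup>2 * (norm c)\<^sup>2 / 2) * exp (- (norm (x - \<sigma>\<^sup>2 *\<^sub>R c))\<^sup>2 / (2 * \<sigma>\<^sup>2))"
      by (metis exp_add)
    then show ?thesis by (simp add: iso_normal_density_def)
  qed
  then have "(\<integral>\<^sup>+x. ennreal (iso_normal_density 0 \<sigma> x * exp (c \<bullet> x)) \<partial>lborel)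
      = ennreal (exp (\<sigma>\<^sup>2 * (norm c)\<^sup>2 / 2))
        * (\<integral>\<^sup>+x. ennreal (iso_normal_density 0 \<sigma> (- (\<sigma>\<^sup>2 *\<^sub>R c) + x)) \<partial>lborel)"
    by (simp add: ennreal_mult nn_integral_cmult)
  also have "(\<integral>\<^sup>+x. ennreal (iso_normal_density 0 \<sigma> (- (\<sigma>\<^sup>2 *\<^sub>R c) + x)) \<partial>lborel)
      = (\<integral>\<^sup>+x. ennreal (iso_normal_density 0 \<sigma> (x :: real ^ 'n)) \<partial>lborel)"
    by (rule nn_integral_lborel_translate) measurable
  also have "\<dots> \<le> 1"
    using nn_integral_gaussian_exp_quadratic_le[of \<sigma> "0 :: real ^ 'n ^ 'n" 0] assms
    by (simp add: sym_psd_def transpose_def vec_eq_iff)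
  finally show ?thesis by (simp add: mult_left_mono)
qed

section \<open>The excess and its exponential moment\<close>

text \<open>
  A weighted Cauchy--Schwarz inequality: the reciprocals of the four weights add up to 1.
  Unequal weights are needed because the terms \<open>u\<close> and \<open>v\<close>, which will be the noise parts of the
  estimators \<open>j\<close> and \<open>k\<close>, are not equally expensive: the quadratic form of \<open>A k\<close> enters the
  excess with a negative sign, so more of it can be spent.
\<close>

lemma norm_square_four_terms_le:
  fixes p q u v :: "'a::real_normed_vector"
  shows "(norm (p - q - u + v))\<^sup>2
    \<le> 4 * (norm p)\<^sup>2 + 4 * (norm q)\<^sup>2 + 5 / 2 * (norm u)\<^sup>2 + 10 * (norm v)\<^sup>2"
proof -
  have *: "(a + b + c + d)\<^sup>2 \<le> 4 * a\<^sup>2 + 4 * b\<^sup>2 + 5 / 2 * c\<^sup>2 + 10 * d\<^sup>2" for a b c d :: real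
  proof -
    \<comment> \<open>the six squares \<open>(w x - w' y)\<^sup>2 / (w w')\<close> over pairs of terms \<open>x, y\<close> with weights \<open>w, w'\<close>\<close>
    have "0 \<le> (a - b)\<^sup>2 + (8 * a - 5 * c)\<^sup>2 / 40 + (8 * b - 5 * c)\<^sup>2 / 40
        + (2 * a - 5 * d)\<^sup>2 / 10 + (2 * b - 5 * d)\<^sup>2 / 10 + (c - 4 * d)\<^sup>2 / 4"
      by simp
    also have "\<dots> = 4 * a\<^sup>2 + 4 * b\<^sup>2 + 5 / 2 * c\<^sup>2 + 10 * d\<^sup>2 - (a + b + c + d)\<^sup>2"
      by (simp add: power2_eq_square field_simps)
    finally show ?thesis by simp
  qed
  have "norm (p - q - u + v) \<le> norm p + norm q + norm u + norm v"
    using norm_triangle_ineq[of "p - q - u" v] norm_triangle_ineq4[of "p - q" u]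
      norm_triangle_ineq4[of p q] by linarith
  then have "(norm (p - q - u + v))\<^sup>2 \<le> (norm p + norm q + norm u + norm v)\<^sup>2"
    by (intro power_mono) auto
  also have "\<dots> \<le> 4 * (norm p)\<^sup>2 + 4 * (norm q)\<^sup>2 + 5 / 2 * (norm u)\<^sup>2 + 10 * (norm v)\<^sup>2"
    by (rule *)
  finally show ?thesis .
qed

text \<open>
  Let \<open>p = r + A x\<close> and \<open>q = s + B x\<close>. The losses \<open>\<parallel>p\<parallel>\<^sup>2\<close> and \<open>\<parallel>q\<parallel>\<^sup>2\<close> are random, whereas the moment
  of the linear part is controlled by the deterministic \<open>\<parallel>r - s\<parallel>\<^sup>2\<close>. The passage from one to the other
  costs multiples of \<open>\<parallel>A x\<parallel>\<^sup>2\<close> and \<open>\<parallel>B x\<parallel>\<^sup>2\<close>. The assumptions on \<open>\<epsilon>\<close> make these at most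
  \<open>(x \<bullet> A x) / 2\<close> and \<open>2 (x \<bullet> B x)\<close>; the latter is exactly cancelled by the contribution
  \<open>- 2 (x \<bullet> B x)\<close> of the cross term, and only the quadratic form of \<open>A\<close> survives.
\<close>

lemma quadratic_noise_absorbed_by_losses:
  fixes A B :: "real ^ 'n ^ 'n" and r s x :: "real ^ 'n"
  assumes "sym_psd A" "sym_psd B" "0 \<le> \<epsilon>" "\<epsilon> * op_norm A \<le> 4 / 5" "\<epsilon> * op_norm B \<le> 4 / 5"
  shows "2 * (x \<bullet> ((r + A *v x) - (s + B *v x)))
      - \<epsilon> * (norm (r + A *v x))\<^sup>2 - \<epsilon> * (norm (s + B *v x))\<^sup>2
    \<le> 2 * (x \<bullet> (r - s)) - \<epsilon> / 4 * (norm (r - s))\<^sup>2 + 5 / 2 * (x \<bullet> (A *v x))"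
proof -
  define p q where "p = r + A *v x" and "q = s + B *v x"
  have absorb: "\<epsilon> * (norm (C *v x))\<^sup>2 \<le> 4 / 5 * (x \<bullet> (C *v x))"
    if "sym_psd C" "\<epsilon> * op_norm C \<le> 4 / 5" for C
  proof -
    have "\<epsilon> * (norm (C *v x))\<^sup>2 \<le> \<epsilon> * (op_norm C * (x \<bullet> (C *v x)))"
      using that(1) assms(3) by (intro mult_left_mono sym_psd_norm_square_le)
    also have "\<dots> = \<epsilon> * op_norm C * (x \<bullet> (C *v x))" by simp
    also have "\<dots> \<le> 4 / 5 * (x \<bullet> (C *v x))"
      using that by (intro mult_right_mono) (auto simp: sym_psd_def)
    finally show ?thesis .
  qed
  have "r - s = p - q - A *v x + B *v x" by (simp add: p_def q_def)
  then have "\<epsilon> * (norm (r - s))\<^sup>2 \<le> \<epsilon> * (4 * (norm p)\<^sup>2 + 4 * (norm q)\<^sup>2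
      + 5 / 2 * (norm (A *v x))\<^sup>2 + 10 * (norm (B *v x))\<^sup>2)"
    using norm_square_four_terms_le assms(3) by (intro mult_left_mono) auto
  then have "\<epsilon> / 4 * (norm (r - s))\<^sup>2 \<le> \<epsilon> * (norm p)\<^sup>2 + \<epsilon> * (norm q)\<^sup>2
      + 1 / 2 * (x \<bullet> (A *v x)) + 2 * (x \<bullet> (B *v x))"
    using absorb[OF assms(1,4)] absorb[OF assms(2,5)] by (simp add: algebra_simps)
  moreover have "x \<bullet> (p - q) = x \<bullet> (r - s) + x \<bullet> (A *v x) - x \<bullet> (B *v x)"
    by (simp add: p_def q_def inner_add_right inner_diff_right)
  ultimately show ?thesis unfolding p_def[symmetric] q_def[symmetric] by simp
qed

text \<open>
  The noise \<open>x\<close> contributes only the cross term to the comparison of the estimators \<open>j\<close> and \<open>k\<close>; what is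
  subtracted makes its exponential moment at scale \<open>lam\<close> at most 1. The penalty pays for the part of
  the cross term that is quadratic in \<open>x\<close> and the losses for the linear part. Their coefficient
  \<open>16 \<sigma>\<^sup>2 / lam\<close> is the least that suffices for the linear part once its exponent has been doubled to
  separate it from the quadratic one.
\<close>

definition excess ::
  "real \<Rightarrow> real \<Rightarrow> real ^ 'n \<Rightarrow> (nat \<Rightarrow> real ^ 'n ^ 'n) \<Rightarrow> (nat \<Rightarrow> real ^ 'n) \<Rightarrow> nat \<Rightarrow> nat \<Rightarrow> real ^ 'n \<Rightarrow> real" where
  "excess \<sigma> lam \<mu> A b j k x =
     2 * (x \<bullet> (affine_est (A j) (b j) (\<mu> + x) - affine_est (A k) (b k) (\<mu> + x)))
     - penalty \<sigma> (A j)
     - 16 * \<sigma>\<^sup>2 / lam * (norm (\<mu> - affine_est (A j) (b j) (\<mu> + x)))\<^sup>2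
     - 16 * \<sigma>\<^sup>2 / lam * (norm (\<mu> - affine_est (A k) (b k) (\<mu> + x)))\<^sup>2"

lemma borel_measurable_affine_est [measurable (raw)]:
  "f \<in> borel_measurable N \<Longrightarrow> (\<lambda>x. affine_est A b (f x)) \<in> borel_measurable N"
proof -
  have "affine_est A b \<in> borel_measurable borel"
    unfolding affine_est_def
    by (intro borel_measurable_continuous_onI continuous_intros
      linear_continuous_on matrix_vector_mul_bounded_linear)
  then show "f \<in> borel_measurable N \<Longrightarrow> (\<lambda>x. affine_est A b (f x)) \<in> borel_measurable N"
    by (rule measurable_compose_rev)
qed

lemma borel_measurable_excess [measurable]: "excess \<sigma> lam \<mu> A b j k \<in> borel_measurable borel"
  unfolding excess_def by measurable

text \<open>
  The exponent is at most \<open>u + w\<close>, with \<open>u\<close> linear and \<open>w\<close> quadratic in the noise, and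
  \<open>exp (u + w) \<le> (exp (2 u) + exp (2 w)) / 2\<close>. In both summands the Gaussian moment bound
  is exactly compensated by the deterministic factor, \<open>f\<close> for the loss terms and \<open>g\<close> for the penalty.
\<close>

lemma nn_integral_exp_excess_le_1:
  fixes A :: "nat \<Rightarrow> real ^ 'n ^ 'n"
  assumes "\<sigma> > 0" "lam > 0" "sym_psd (A j)" "sym_psd (A k)"
    and "20 * \<sigma>\<^sup>2 * op_norm (A j) \<le> lam" "20 * \<sigma>\<^sup>2 * op_norm (A k) \<le> lam"
  shows "(\<integral>\<^sup>+x. ennreal (iso_normal_density 0 \<sigma> x * exp (excess \<sigma> lam \<mu> A b j k x / lam)) \<partial>lborel) \<le> 1"
proof -
  define r where "r i = A i *v \<mu> + b i - \<mu>" for i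
  define d where "d = r j - r k"
  define F where "F x = iso_normal_density 0 \<sigma> x * exp (((4 / lam) *\<^sub>R d) \<bullet> x)" for x
  define G where "G x = iso_normal_density 0 \<sigma> x * exp (5 / lam * (x \<bullet> (A j *v x)))" for x
  define f where "f = exp (- (8 * \<sigma>\<^sup>2 / lam\<^sup>2 * (norm d)\<^sup>2))"
  define g where "g = exp (- (8 * \<sigma>\<^sup>2 / lam * trace (A j)))"
  have [measurable]: "(\<lambda>x. A j *v x) \<in> borel_measurable borel"
    by (intro borel_measurable_continuous_onI linear_continuous_on matrix_vector_mul_bounded_linear)
  have [measurable]: "F \<in> borel_measurable borel" "G \<in> borel_measurable borel"
    unfolding F_def G_def by measurable
  have nonneg [simp]: "0 \<le> F x" "0 \<le> G x" "0 \<le> f" "0 \<le> g" for x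
    by (simp_all add: F_def G_def f_def g_def)
  have pointwise: "iso_normal_density 0 \<sigma> x * exp (excess \<sigma> lam \<mu> A b j k x / lam)
      \<le> 1 / 2 * (f * F x + g * G x)" for x
  proof -
    have est: "affine_est (A i) (b i) (\<mu> + x) - \<mu> = r i + A i *v x" for i
      by (simp add: affine_est_def r_def matrix_vector_right_distrib)
    have est_diff: "affine_est (A j) (b j) (\<mu> + x) - affine_est (A k) (b k) (\<mu> + x)
        = (r j + A j *v x) - (r k + A k *v x)"
      unfolding est[symmetric] by simp
    have "excess \<sigma> lam \<mu> A b j k x
        = 2 * (x \<bullet> ((r j + A j *v x) - (r k + A k *v x)))
          - 16 * \<sigma>\<^sup>2 / lam * (norm (r j + A j *v x))\<^sup>2
          - 16 * \<sigma>\<^sup>2 / lam * (norm (r k + A k *v x))\<^sup>2 - penalty \<sigma> (A j)"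
      unfolding excess_def est_diff norm_minus_commute[of \<mu>] est by simp
    also have "\<dots> \<le> 2 * (x \<bullet> (r j - r k)) - 16 * \<sigma>\<^sup>2 / lam / 4 * (norm (r j - r k))\<^sup>2
        + 5 / 2 * (x \<bullet> (A j *v x)) - penalty \<sigma> (A j)"
      using assms
      by (intro diff_right_mono quadratic_noise_absorbed_by_losses) (auto simp: field_simps)
    finally have "excess \<sigma> lam \<mu> A b j k x / lam
      \<le> (2 * (x \<bullet> d) - 16 * \<sigma>\<^sup>2 / lam / 4 * (norm d)\<^sup>2
        + 5 / 2 * (x \<bullet> (A j *v x)) - penalty \<sigma> (A j)) / lam"
      unfolding d_def using assms(2) by (intro divide_right_mono) auto
    also have "\<dots> = (2 / lam * (d \<bullet> x) - 4 * \<sigma>\<^sup>2 / lam\<^sup>2 * (norm d)\<^sup>2)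
        + (5 / (2 * lam) * (x \<bullet> (A j *v x)) - 4 * \<sigma>\<^sup>2 / lam * trace (A j))" (is "_ = ?u + ?w")
      using assms(2) by (simp add: penalty_def inner_commute power2_eq_square field_simps)
    finally have "exp (excess \<sigma> lam \<mu> A b j k x / lam) \<le> exp ?u * exp ?w"
      by (simp add: exp_add[symmetric])
    also have "\<dots> \<le> 1 / 2 * ((exp ?u)\<^sup>2 + (exp ?w)\<^sup>2)"
      using sum_squares_bound[of "exp ?u" "exp ?w"] by simp
    also have "(exp ?u)\<^sup>2 = f * exp (((4 / lam) *\<^sub>R d) \<bullet> x)"
      by (simp add: f_def exp_add[symmetric] exp_double[symmetric] algebra_simps)
    also have "(exp ?w)\<^sup>2 = g * exp (5 / lam * (x \<bullet> (A j *v x)))"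
      by (simp add: g_def exp_add[symmetric] exp_double[symmetric] algebra_simps)
    finally have "iso_normal_density 0 \<sigma> x * exp (excess \<sigma> lam \<mu> A b j k x / lam)
        \<le> iso_normal_density 0 \<sigma> x * (1 / 2 * (f * exp (((4 / lam) *\<^sub>R d) \<bullet> x)
          + g * exp (5 / lam * (x \<bullet> (A j *v x)))))"
      by (intro mult_left_mono) auto
    then show ?thesis by (simp add: F_def G_def algebra_simps)
  qed
  have "(\<integral>\<^sup>+x. ennreal (iso_normal_density 0 \<sigma> x * exp (excess \<sigma> lam \<mu> A b j k x / lam)) \<partial>lborel)
      \<le> (\<integral>\<^sup>+x. ennreal (1 / 2) * (ennreal f * ennreal (F x) + ennreal g * ennreal (G x)) \<partial>lborel)"
  proof (rule nn_integral_mono)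
    fix x
    have "ennreal (1 / 2) * (ennreal f * ennreal (F x) + ennreal g * ennreal (G x))
        = ennreal (1 / 2 * (f * F x + g * G x))"
      by (simp only: ennreal_mult' ennreal_plus nonneg mult_nonneg_nonneg)
    then show "ennreal (iso_normal_density 0 \<sigma> x * exp (excess \<sigma> lam \<mu> A b j k x / lam))
        \<le> ennreal (1 / 2) * (ennreal f * ennreal (F x) + ennreal g * ennreal (G x))"
      using pointwise by (simp only: ennreal_leI)
  qed
  also have "\<dots> = ennreal (1 / 2)
      * (ennreal f * (\<integral>\<^sup>+x. ennreal (F x) \<partial>lborel) + ennreal g * (\<integral>\<^sup>+x. ennreal (G x) \<partial>lborel))"
    by (simp add: nn_integral_cmult nn_integral_add)
  also have "\<dots> \<le> ennreal (1 / 2) * (1 + 1)"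
  proof (intro mult_left_mono add_mono)
    have "(\<integral>\<^sup>+x. ennreal (F x) \<partial>lborel) \<le> ennreal (exp (\<sigma>\<^sup>2 * (norm ((4 / lam) *\<^sub>R d))\<^sup>2 / 2))"
      unfolding F_def by (rule nn_integral_gaussian_exp_linear_le[OF assms(1)])
    then have "ennreal f * (\<integral>\<^sup>+x. ennreal (F x) \<partial>lborel)
        \<le> ennreal f * ennreal (exp (\<sigma>\<^sup>2 * (norm ((4 / lam) *\<^sub>R d))\<^sup>2 / 2))"
      by (intro mult_left_mono) auto
    also have "\<dots> = 1"
      using assms(2)
      by (simp add: f_def ennreal_mult'[symmetric] exp_add[symmetric] power_mult_distrib power_divide)
    finally show "ennreal f * (\<integral>\<^sup>+x. ennreal (F x) \<partial>lborel) \<le> 1" .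
    have "(\<integral>\<^sup>+x. ennreal (G x) \<partial>lborel) \<le> ennreal (exp (8 / 5 * \<sigma>\<^sup>2 * (5 / lam) * trace (A j)))"
      unfolding G_def using assms
      by (intro nn_integral_gaussian_exp_quadratic_le) (auto simp: field_simps)
    then have "ennreal g * (\<integral>\<^sup>+x. ennreal (G x) \<partial>lborel)
        \<le> ennreal g * ennreal (exp (8 / 5 * \<sigma>\<^sup>2 * (5 / lam) * trace (A j)))"
      by (intro mult_left_mono) auto
    also have "\<dots> = 1"
      by (simp add: g_def ennreal_mult'[symmetric] exp_add[symmetric])
    finally show "ennreal g * (\<integral>\<^sup>+x. ennreal (G x) \<partial>lborel) \<le> 1" .
  qed auto
  also have "\<dots> = 1"
  proof -
    have "(1 + 1 :: ennreal) = ennreal 2" by simp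
    then show ?thesis by (simp only: ennreal_mult'[symmetric]) simp
  qed
  finally show ?thesis .
qed

section \<open>From the excess to the losses\<close>

text \<open>
  One half of the Gibbs variational principle, applied to the Gibbs weights themselves: in Jensen's
  inequality for \<open>exp\<close>, the factor \<open>exp (- g j / lam)\<close> in the weights cancels, which leaves the
  \<open>\<pi>\<close>-average of \<open>exp (z j / lam)\<close> over the normalizing constant, and the latter is at least its
  \<open>k\<close>-th term.
\<close>

lemma gibbs_average_le:
  fixes \<pi> g z :: "nat \<Rightarrow> real" and w :: "nat \<Rightarrow> real"
  assumes "finite I" "k \<in> I" "lam > 0"
    and "\<And>j. j \<in> I \<Longrightarrow> 0 \<le> \<pi> j" "0 < \<pi> k"
    and w: "\<And>j. j \<in> I \<Longrightarrow> w j = \<pi> j * exp (- g j / lam)"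
    and K: "(\<Sum>j\<in>I. \<pi> j * exp (z j / lam)) \<le> K"
  shows "(\<Sum>j\<in>I. w j / sum w I * (z j + g j)) \<le> g k + lam * ln (K / \<pi> k)"
proof -
  define S where "S = sum w I"
  define m where "m = (\<Sum>j\<in>I. w j / S * ((z j + g j) / lam))"
  have w_nonneg: "0 \<le> w j" if "j \<in> I" for j
    using that assms(4) w by simp
  have "w k \<le> S"
    unfolding S_def using assms(1,2) w_nonneg by (intro member_le_sum) auto
  moreover have wk: "0 < w k" using assms(2,5) w by simp
  ultimately have S: "0 < S" by simp
  have "exp m \<le> (\<Sum>j\<in>I. w j / S * exp ((z j + g j) / lam))"
    using convex_on_sum[OF assms(1) _ exp_convex, of "\<lambda>j. w j / S" "\<lambda>j. (z j + g j) / lam"]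
      assms(2) w_nonneg S by (auto simp: m_def S_def sum_divide_distrib[symmetric])
  also have "\<dots> = (\<Sum>j\<in>I. \<pi> j * exp (z j / lam)) / S"
    unfolding sum_divide_distrib
    by (intro sum.cong refl) (simp add: w exp_add[symmetric] add_divide_distrib)
  also have "\<dots> \<le> K / S"
    using K S by (intro divide_right_mono) auto
  finally have m_le: "exp m \<le> K / S" .
  then have "0 < K / S" by (rule less_le_trans[OF exp_gt_zero])
  then have "0 < K" using S by (simp add: zero_less_divide_iff)
  have "exp m \<le> K / w k"
    using m_le \<open>w k \<le> S\<close> wk \<open>0 < K\<close> by (smt (verit) divide_left_mono mult_pos_pos S)
  also have "\<dots> = exp (ln (K / \<pi> k) + g k / lam)"
    using \<open>0 < K\<close> assms(2,5) by (simp add: w exp_add exp_minus field_simps)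
  finally have "lam * m \<le> lam * (ln (K / \<pi> k) + g k / lam)"
    using assms(3) by (intro mult_left_mono) auto
  moreover have "lam * m = (\<Sum>j\<in>I. w j / S * (z j + g j))"
    using assms(3) by (simp add: m_def sum_distrib_left)
  ultimately show ?thesis
    using assms(3) by (simp add: S_def algebra_simps)
qed

lemma norm_square_convex_combination_le:
  fixes v :: "'i \<Rightarrow> 'a::real_normed_vector"
  assumes "finite I" "\<And>i. i \<in> I \<Longrightarrow> 0 \<le> c i" "sum c I = 1"
  shows "(norm (\<Sum>i\<in>I. c i *\<^sub>R v i))\<^sup>2 \<le> (\<Sum>i\<in>I. c i * (norm (v i))\<^sup>2)"
proof -
  have "norm (\<Sum>i\<in>I. c i *\<^sub>R v i) \<le> (\<Sum>i\<in>I. c i * norm (v i))"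
    using assms(2) by (intro order_trans[OF norm_sum] sum_mono) simp
  then have "(norm (\<Sum>i\<in>I. c i *\<^sub>R v i))\<^sup>2 \<le> (\<Sum>i\<in>I. c i * norm (v i))\<^sup>2"
    by (intro power_mono) auto
  also have "\<dots> \<le> (\<Sum>i\<in>I. c i * (norm (v i))\<^sup>2)"
    using convex_on_sum[OF assms(1) _ convex_power2 assms(3), of "\<lambda>i. norm (v i)"] assms
    by (cases "I = {}") auto
  finally show ?thesis .
qed

text \<open>
  The deterministic part of the theorem. A single row \<open>k\<close> of the double sum is at most the whole,
  which costs a factor \<open>1 / \<pi> k\<close>; the Gibbs bound costs another one, hence \<open>2 lam\<close> times the
  logarithm. Both logarithms are merged using \<open>\<delta> \<le> 1\<close>.
\<close>

lemma ew_oracle_inequality_of_excess_bound: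
  fixes A :: "nat \<Rightarrow> real ^ 'n ^ 'n"
  assumes "lam \<ge> 64 * \<sigma>\<^sup>2" "lam > 0" "0 < \<delta>" "\<delta> \<le> 1"
    and psd: "\<And>j. j \<in> {1..M} \<Longrightarrow> sym_psd (A j)"
    and \<pi>: "\<And>j. j \<in> {1..M} \<Longrightarrow> \<pi> j \<ge> 0" "(\<Sum>j = 1..M. \<pi> j) = 1"
    and excess: "(\<Sum>k = 1..M. \<Sum>j = 1..M. \<pi> k * \<pi> j * exp (excess \<sigma> lam \<mu> A b j k x / lam)) \<le> 1 / \<delta>"
    and k: "k \<in> {1..M}" "\<pi> k > 0"
  shows "(norm (\<mu> - ew_aggregate M \<sigma> lam A b \<pi> (\<mu> + x)))\<^sup>2
    \<le> (1 + 128 * \<sigma>\<^sup>2 / (3 * lam)) * (norm (\<mu> - affine_est (A k) (b k) (\<mu> + x)))\<^sup>2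
      + 3 * lam * ln (1 / (\<delta> * \<pi> k)) + 2 * penalty \<sigma> (A k)"
proof -
  define e where "e j = affine_est (A j) (b j) (\<mu> + x)" for j
  define L where "L j = (norm (\<mu> - e j))\<^sup>2" for j
  define C where "C j = penalty \<sigma> (A j)" for j
  define g where "g j = (norm (\<mu> + x - e j))\<^sup>2 + C j" for j
  define w where "w = ew_unnormalized \<sigma> lam A b \<pi> (\<mu> + x)"
  define \<theta> where "\<theta> = ew_weight M \<sigma> lam A b \<pi> (\<mu> + x)"
  define \<epsilon> where "\<epsilon> = 16 * \<sigma>\<^sup>2 / lam"
  define l where "l = ln (1 / (\<delta> * \<pi> k))"
  define Lav where "Lav = (\<Sum>j = 1..M. \<theta> j * L j)"
  have w: "w j = \<pi> j * exp (- g j / lam)" for j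
    by (simp add: w_def ew_unnormalized_def g_def e_def C_def)
  have \<theta>: "\<theta> j = w j / sum w {1..M}" for j
    by (simp add: \<theta>_def ew_weight_def w_def)
  have w_nonneg: "0 \<le> w j" if "j \<in> {1..M}" for j using that \<pi>(1) by (simp add: w)
  have "0 < w k" using k(2) by (simp add: w)
  also have "w k \<le> sum w {1..M}" using k(1) w_nonneg by (intro member_le_sum) auto
  finally have W: "0 < sum w {1..M}" .
  have \<theta>_nonneg: "0 \<le> \<theta> j" if "j \<in> {1..M}" for j using that w_nonneg W by (simp add: \<theta>)
  have \<theta>_sum: "sum \<theta> {1..M} = 1" using W by (simp add: \<theta> sum_divide_distrib[symmetric])
  have \<epsilon>: "0 \<le> \<epsilon>" "\<epsilon> \<le> 1 / 4"
    using assms(1,2) by (simp_all add: \<epsilon>_def field_simps)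
  have C_nonneg: "0 \<le> C k"
    using sym_psd_trace_nonneg[OF psd[OF k(1)]] by (simp add: C_def penalty_def)
  have "\<pi> k \<le> 1" using k(1) \<pi> member_le_sum[of k "{1..M}" \<pi>] by auto
  then have "\<delta> * \<pi> k \<le> 1" using assms(3,4) k(2) by (simp add: mult_le_one)
  then have l: "0 \<le> l" using assms(3) k(2) by (simp add: l_def)
  have row: "(\<Sum>j = 1..M. \<pi> k * \<pi> j * exp (excess \<sigma> lam \<mu> A b j k x / lam)) \<le> 1 / \<delta>"
  proof (rule order_trans[OF member_le_sum excess])
    show "k \<in> {1..M}" by (rule k(1))
  qed (auto intro!: sum_nonneg mult_nonneg_nonneg \<pi>(1))
  have K: "(\<Sum>j = 1..M. \<pi> j * exp (excess \<sigma> lam \<mu> A b j k x / lam)) \<le> 1 / (\<delta> * \<pi> k)"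
  proof -
    have "\<pi> k * (\<Sum>j = 1..M. \<pi> j * exp (excess \<sigma> lam \<mu> A b j k x / lam)) \<le> 1 / \<delta>"
      using row by (simp add: sum_distrib_left mult.assoc)
    then show ?thesis using k(2) assms(3) by (simp add: field_simps)
  qed
  have "(\<Sum>j = 1..M. \<theta> j * (excess \<sigma> lam \<mu> A b j k x + g j))
      \<le> g k + lam * ln (1 / (\<delta> * \<pi> k) / \<pi> k)"
    unfolding \<theta> using gibbs_average_le[OF _ k(1) assms(2) \<pi>(1) k(2) w K] by simp
  also have "ln (1 / (\<delta> * \<pi> k) / \<pi> k) \<le> 2 * l"
  proof -
    have "1 / (\<delta> * \<pi> k) / \<pi> k \<le> (1 / (\<delta> * \<pi> k))\<^sup>2"
      using assms(3,4) k(2) by (simp add: field_simps power2_eq_square)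
    then have "ln (1 / (\<delta> * \<pi> k) / \<pi> k) \<le> ln ((1 / (\<delta> * \<pi> k))\<^sup>2)"
      using assms(3) k(2) by (intro ln_mono) auto
    then show ?thesis using assms(3) k(2) by (simp add: ln_realpow l_def)
  qed
  also have "(\<Sum>j = 1..M. \<theta> j * (excess \<sigma> lam \<mu> A b j k x + g j))
      = (1 - \<epsilon>) * Lav - (1 + \<epsilon>) * L k + g k - C k"
  proof -
    have "excess \<sigma> lam \<mu> A b j k x + g j = (1 - \<epsilon>) * L j + (g k - (1 + \<epsilon>) * L k - C k)" for j
    proof -
      have sq: "(norm (\<mu> + x - e i))\<^sup>2 = L i + 2 * (x \<bullet> (\<mu> - e i)) + (norm x)\<^sup>2" for i
      proof -
        show ?thesis
          unfolding L_def power2_norm_eq_inner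
          by (simp add: inner_diff_left inner_diff_right inner_add_left inner_add_right inner_commute)
      qed
      have "excess \<sigma> lam \<mu> A b j k x = 2 * (x \<bullet> (e j - e k)) - C j - \<epsilon> * L j - \<epsilon> * L k"
        by (simp only: excess_def e_def L_def C_def \<epsilon>_def)
      then show ?thesis
        using sq[of j] sq[of k] by (simp add: g_def inner_diff_right algebra_simps)
    qed
    then have "(\<Sum>j = 1..M. \<theta> j * (excess \<sigma> lam \<mu> A b j k x + g j))
        = (1 - \<epsilon>) * Lav + (g k - (1 + \<epsilon>) * L k - C k) * sum \<theta> {1..M}"
      by (simp add: Lav_def distrib_left sum.distrib sum_distrib_left sum_distrib_right
        mult.left_commute mult.commute)
    then show ?thesis unfolding \<theta>_sum by simp
  qed
  finally have main: "(1 - \<epsilon>) * Lav \<le> (1 + \<epsilon>) * L k + C k + 2 * lam * l"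
    using assms(2) by simp
  have "Lav \<le> (1 + 8 / 3 * \<epsilon>) * L k + 4 / 3 * C k + 8 / 3 * lam * l"
  proof -
    \<comment> \<open>\<open>(1 - \<epsilon>) R\<close> exceeds the right-hand side of \<open>main\<close> by \<open>1 / 4 - \<epsilon>\<close> times a nonnegative quantity\<close>
    define R where "R = (1 + 8 / 3 * \<epsilon>) * L k + 4 / 3 * C k + 8 / 3 * lam * l"
    have "0 \<le> (1 / 4 - \<epsilon>) * (8 / 3 * \<epsilon> * L k + 4 / 3 * C k + 8 / 3 * lam * l)"
      using \<epsilon> C_nonneg l assms(2) by (intro mult_nonneg_nonneg add_nonneg_nonneg) (auto simp: L_def)
    then have "(1 + \<epsilon>) * L k + C k + 2 * lam * l \<le> (1 - \<epsilon>) * R"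
      by (simp add: R_def field_simps)
    with main have "(1 - \<epsilon>) * Lav \<le> (1 - \<epsilon>) * R" by simp
    then show ?thesis using \<epsilon> by (simp add: R_def)
  qed
  also have "\<dots> \<le> (1 + 128 * \<sigma>\<^sup>2 / (3 * lam)) * L k + 2 * C k + 3 * lam * l"
    using C_nonneg l assms(2) by (intro add_mono mult_right_mono) (auto simp: L_def \<epsilon>_def field_simps)
  also have "Lav \<ge> (norm (\<mu> - ew_aggregate M \<sigma> lam A b \<pi> (\<mu> + x)))\<^sup>2"
  proof -
    have "ew_aggregate M \<sigma> lam A b \<pi> (\<mu> + x) = (\<Sum>j = 1..M. \<theta> j *\<^sub>R e j)"
      by (simp add: ew_aggregate_def \<theta>_def e_def)
    moreover have "(\<Sum>j = 1..M. \<theta> j *\<^sub>R \<mu>) = \<mu>"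
      unfolding scaleR_sum_left[symmetric] \<theta>_sum by simp
    ultimately have "\<mu> - ew_aggregate M \<sigma> lam A b \<pi> (\<mu> + x) = (\<Sum>j = 1..M. \<theta> j *\<^sub>R (\<mu> - e j))"
      by (simp add: scaleR_right_diff_distrib sum_subtractf)
    then show ?thesis
      unfolding Lav_def L_def
      using norm_square_convex_combination_le[OF _ \<theta>_nonneg \<theta>_sum] by simp
  qed
  finally show ?thesis by (simp add: L_def C_def e_def l_def)
qed

section \<open>The oracle inequality in probability\<close>

lemma nn_integral_mixture_exp_excess_le_1:
  fixes A :: "nat \<Rightarrow> real ^ 'n ^ 'n"
  assumes "\<sigma> > 0" "lam > 0"
    and "\<And>j. j \<in> {1..M} \<Longrightarrow> sym_psd (A j)" "\<And>j. j \<in> {1..M} \<Longrightarrow> 20 * \<sigma>\<^sup>2 * op_norm (A j) \<le> lam"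
    and \<pi>: "\<And>j. j \<in> {1..M} \<Longrightarrow> \<pi> j \<ge> 0" "(\<Sum>j = 1..M. \<pi> j) = 1"
  shows "(\<integral>\<^sup>+x. ennreal (iso_normal_density 0 \<sigma> x)
      * ennreal (\<Sum>k = 1..M. \<Sum>j = 1..M. \<pi> k * \<pi> j * exp (excess \<sigma> lam \<mu> A b j k x / lam)) \<partial>lborel) \<le> 1"
proof -
  define F where "F j k x = iso_normal_density 0 \<sigma> x * exp (excess \<sigma> lam \<mu> A b j k x / lam)" for j k x
  have [measurable]: "F j k \<in> borel_measurable borel" for j k
    unfolding F_def by measurable
  have nonneg: "0 \<le> F j k x" for j k x by (simp add: F_def)
  have "(\<integral>\<^sup>+x. ennreal (iso_normal_density 0 \<sigma> x)
      * ennreal (\<Sum>k = 1..M. \<Sum>j = 1..M. \<pi> k * \<pi> j * exp (excess \<sigma> lam \<mu> A b j k x / lam)) \<partial>lborel)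
    = (\<integral>\<^sup>+x. (\<Sum>k = 1..M. \<Sum>j = 1..M. ennreal (\<pi> k * \<pi> j) * ennreal (F j k x)) \<partial>lborel)"
  proof (rule nn_integral_cong)
    fix x
    have "(\<Sum>k = 1..M. \<Sum>j = 1..M. ennreal (\<pi> k * \<pi> j) * ennreal (F j k x))
        = (\<Sum>k = 1..M. \<Sum>j = 1..M. ennreal (\<pi> k * \<pi> j * F j k x))"
      using \<pi>(1) nonneg by (intro sum.cong refl) (simp add: ennreal_mult)
    also have "\<dots> = (\<Sum>k = 1..M. ennreal (\<Sum>j = 1..M. \<pi> k * \<pi> j * F j k x))"
      using \<pi>(1) nonneg by (intro sum.cong refl sum_ennreal) simp
    also have "\<dots> = ennreal (\<Sum>k = 1..M. \<Sum>j = 1..M. \<pi> k * \<pi> j * F j k x)"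
      using \<pi>(1) nonneg by (intro sum_ennreal sum_nonneg) simp
    also have "(\<Sum>k = 1..M. \<Sum>j = 1..M. \<pi> k * \<pi> j * F j k x) = iso_normal_density 0 \<sigma> x
        * (\<Sum>k = 1..M. \<Sum>j = 1..M. \<pi> k * \<pi> j * exp (excess \<sigma> lam \<mu> A b j k x / lam))"
      by (simp add: F_def sum_distrib_left mult_ac)
    finally show "ennreal (iso_normal_density 0 \<sigma> x)
      * ennreal (\<Sum>k = 1..M. \<Sum>j = 1..M. \<pi> k * \<pi> j * exp (excess \<sigma> lam \<mu> A b j k x / lam))
      = (\<Sum>k = 1..M. \<Sum>j = 1..M. ennreal (\<pi> k * \<pi> j) * ennreal (F j k x))"
      by (simp add: ennreal_mult')
  qed
  also have "\<dots> = (\<Sum>k = 1..M. \<Sum>j = 1..M. ennreal (\<pi> k * \<pi> j) * (\<integral>\<^sup>+x. ennreal (F j k x) \<partial>lborel))"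
    by (simp add: nn_integral_sum nn_integral_cmult)
  also have "\<dots> \<le> (\<Sum>k = 1..M. \<Sum>j = 1..M. ennreal (\<pi> k * \<pi> j) * 1)"
    unfolding F_def using assms
    by (intro sum_mono mult_left_mono nn_integral_exp_excess_le_1) auto
  also have "\<dots> = (\<Sum>k = 1..M. ennreal (\<pi> k * (\<Sum>j = 1..M. \<pi> j)))"
    unfolding sum_distrib_left mult_1_right
    using \<pi>(1) by (intro sum.cong refl sum_ennreal) simp
  also have "\<dots> = 1"
    using \<pi> by (subst sum_ennreal) simp_all
  finally show ?thesis .
qed

lemma borel_measurable_ew_aggregate [measurable (raw)]:
  assumes [measurable]: "f \<in> borel_measurable N"
  shows "(\<lambda>x. ew_aggregate M \<sigma> lam A b \<pi> (f x)) \<in> borel_measurable N"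
  unfolding ew_aggregate_def ew_weight_def ew_unnormalized_def by measurable

theorem theorem2:
  fixes P :: "'w measure"
    and \<mu> :: "real ^ 'n"
    and \<xi> Y :: "'w \<Rightarrow> real ^ 'n"
    and A :: "nat \<Rightarrow> real ^ 'n ^ 'n"
    and b :: "nat \<Rightarrow> real ^ 'n"
    and \<pi> :: "nat \<Rightarrow> real"
    and \<sigma> V lam \<delta> :: real
    and M :: nat
  assumes "prob_space P"
    and "M \<ge> 2"
    and "\<sigma> > 0"
    and "distributed P lborel \<xi> (\<lambda>x. ennreal (iso_normal_density 0 \<sigma> x))"
    and "\<And>\<omega>. \<omega> \<in> space P \<Longrightarrow> Y \<omega> = \<mu> + \<xi> \<omega>"
    and "\<And>j. j \<in> {1..M} \<Longrightarrow> sym_psd (A j)"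
    and "\<And>j. j \<in> {1..M} \<Longrightarrow> \<pi> j \<ge> 0"
    and "(\<Sum>j = 1..M. \<pi> j) = 1"
    and "V = (MAX j\<in>{1..M}. op_norm (A j))"
    and "V > 0"
    and "lam \<ge> 4 * \<sigma>\<^sup>2 * max 16 (5 * V)"
    and "\<delta> > 0"
  shows "measure P {\<omega> \<in> space P.
      ereal ((norm (\<mu> - ew_aggregate M \<sigma> lam A b \<pi> (Y \<omega>)))\<^sup>2)
        \<le> (MIN j\<in>{1..M}.
             ereal ((1 + 128 * \<sigma>\<^sup>2 / (3 * lam)) * (norm (\<mu> - affine_est (A j) (b j) (Y \<omega>)))\<^sup>2)
               + ereal (3 * lam) * log_recip (\<delta> * \<pi> j)
               + ereal (2 * penalty \<sigma> (A j)))}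
    \<ge> 1 - \<delta>" (is "measure P ?T \<ge> 1 - \<delta>")
proof (cases "\<delta> \<le> 1")
  case False
  then show ?thesis using measure_nonneg[of P ?T] by linarith
next
  case True
  interpret prob_space P by fact
  have [measurable]: "\<xi> \<in> borel_measurable P"
    using distributed_measurable[OF assms(4)] by simp
  have [measurable]: "Y \<in> borel_measurable P"
    by (subst measurable_cong[OF assms(5)]) measurable
  have "4 * \<sigma>\<^sup>2 * 16 \<le> 4 * \<sigma>\<^sup>2 * max 16 (5 * V)" "4 * \<sigma>\<^sup>2 * (5 * V) \<le> 4 * \<sigma>\<^sup>2 * max 16 (5 * V)"
    by (intro mult_left_mono; simp)+
  then have lam: "64 * \<sigma>\<^sup>2 \<le> lam" "20 * \<sigma>\<^sup>2 * V \<le> lam" using assms(11) by linarith+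
  have "0 < 64 * \<sigma>\<^sup>2" using assms(3) by simp
  then have lam_pos: "0 < lam" using lam(1) by linarith
  have op_le: "20 * \<sigma>\<^sup>2 * op_norm (A j) \<le> lam" if "j \<in> {1..M}" for j
  proof -
    have "op_norm (A j) \<le> V" unfolding assms(9) using that by (intro Max_ge) auto
    then have "20 * \<sigma>\<^sup>2 * op_norm (A j) \<le> 20 * \<sigma>\<^sup>2 * V" by (intro mult_left_mono) auto
    with lam(2) show ?thesis by simp
  qed
  define N where "N x = (\<Sum>k = 1..M. \<Sum>j = 1..M. \<pi> k * \<pi> j * exp (excess \<sigma> lam \<mu> A b j k x / lam))" for x
  have [measurable]: "N \<in> borel_measurable borel" unfolding N_def by measurable
  have N_nonneg: "0 \<le> N x" for x
    unfolding N_def using assms(7) by (intro sum_nonneg mult_nonneg_nonneg) auto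
  \<comment> \<open>the exceptional event of Markov's inequality; outside of it, \<open>N (\<xi> \<omega>) < 1 / \<delta>\<close>\<close>
  define B where "B = {\<omega> \<in> space P. 1 \<le> ennreal \<delta> * ennreal (N (\<xi> \<omega>))}"
  have [measurable]: "B \<in> sets P" unfolding B_def by measurable
  have "emeasure P B \<le> ennreal \<delta> * (\<integral>\<^sup>+\<omega>. ennreal (N (\<xi> \<omega>)) * indicator (space P) \<omega> \<partial>P)"
    unfolding B_def by (rule nn_integral_Markov_inequality) measurable
  also have "(\<integral>\<^sup>+\<omega>. ennreal (N (\<xi> \<omega>)) * indicator (space P) \<omega> \<partial>P) = (\<integral>\<^sup>+\<omega>. ennreal (N (\<xi> \<omega>)) \<partial>P)"
    by (intro nn_integral_cong) simp
  also have "\<dots> = (\<integral>\<^sup>+x. ennreal (iso_normal_density 0 \<sigma> x) * ennreal (N x) \<partial>lborel)"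
    by (rule distributed_nn_integral[OF assms(4), symmetric]) measurable
  also have "\<dots> \<le> 1"
    unfolding N_def
    using assms(3) lam_pos assms(6) op_le assms(7,8) by (rule nn_integral_mixture_exp_excess_le_1)
  finally have "emeasure P B \<le> ennreal \<delta>" by (simp add: mult_left_mono)
  then have "prob B \<le> \<delta>"
    using assms(12) by (simp add: emeasure_eq_measure)
  moreover have "space P - B \<subseteq> ?T"
  proof
    fix \<omega> assume \<omega>: "\<omega> \<in> space P - B"
    then have "ennreal (\<delta> * N (\<xi> \<omega>)) < 1"
      using assms(12) N_nonneg by (simp add: B_def ennreal_mult not_le)
    then have "N (\<xi> \<omega>) \<le> 1 / \<delta>"
      using assms(12) by (simp add: ennreal_less_one_iff field_simps)
    have Y: "Y \<omega> = \<mu> + \<xi> \<omega>" using \<omega> assms(5) by simp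
    have "ereal ((norm (\<mu> - ew_aggregate M \<sigma> lam A b \<pi> (Y \<omega>)))\<^sup>2)
        \<le> ereal ((1 + 128 * \<sigma>\<^sup>2 / (3 * lam)) * (norm (\<mu> - affine_est (A k) (b k) (Y \<omega>)))\<^sup>2)
          + ereal (3 * lam) * log_recip (\<delta> * \<pi> k) + ereal (2 * penalty \<sigma> (A k))"
      if k: "k \<in> {1..M}" for k
    proof (cases "\<pi> k = 0")
      case True
      then show ?thesis using lam_pos by (simp add: log_recip_def)
    next
      case False
      then have "0 < \<pi> k" using assms(7)[OF k] by simp
      with ew_oracle_inequality_of_excess_bound[OF lam(1) lam_pos assms(12) \<open>\<delta> \<le> 1\<close> assms(6,7,8)
          \<open>N (\<xi> \<omega>) \<le> 1 / \<delta>\<close>[unfolded N_def] k]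
      show ?thesis using assms(12) by (simp add: Y log_recip_def)
    qed
    then show "\<omega> \<in> ?T" using \<omega> assms(2) by (simp add: Min_ge_iff)
  qed
  moreover have "?T \<in> sets P"
  proof -
    define F where "F \<omega> = ereal ((norm (\<mu> - ew_aggregate M \<sigma> lam A b \<pi> (Y \<omega>)))\<^sup>2)" for \<omega>
    define H where "H j c d \<omega> = ereal ((1 + 128 * \<sigma>\<^sup>2 / (3 * lam))
      * (norm (\<mu> - affine_est (A j) (b j) (Y \<omega>)))\<^sup>2) + c + d" for j \<omega> and c d :: ereal
    have [measurable]: "F \<in> borel_measurable P" unfolding F_def by measurable
    have [measurable]: "H j c d \<in> borel_measurable P" for j c d unfolding H_def by measurable
    have "?T = {\<omega> \<in> space P. \<forall>j\<in>{1..M}.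
        F \<omega> \<le> H j (ereal (3 * lam) * log_recip (\<delta> * \<pi> j)) (ereal (2 * penalty \<sigma> (A j))) \<omega>}"
      using assms(2) by (simp add: Min_ge_iff F_def H_def)
    also have "\<dots> \<in> sets P" by measurable
    finally show ?thesis .
  qed
  ultimately have "prob (space P - B) \<le> prob ?T"
    by (intro finite_measure_mono)
  then show ?thesis using \<open>prob B \<le> \<delta>\<close> prob_compl[of B] by simp
qed

end
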